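(* There is an absolute constant $C>0$ such that for all real $r\ge 1$ and all $Z>0$, $$|\Lambda(r,Z)|\le C\left( Z\left(\log r+|\log Z|\right)+Z^{3/2}\,r\right).$$
   Context: Let $0<\delta\le 1/4$ and let $g:(0,\infty)\to[0,1]$ be a smoothed characteristic function of the interval $[1/2,1]$: $g$ is $C^\infty$, $g(x)=1$ for $1/2\le x\le 1$, and $g(x)=0$ for $x\le 1/2-\delta$ and for $x\ge 1+\delta$. The constant in the claim does not depend on $\delta$ or $g$. For $r>0$ and $Z>0$ put $a=1/Z$ and $$\Lambda(r,Z)=\frac{\Gamma^2(1/2+ir)}{\Gamma(1+2ir)}\int_{0}^{\infty}\frac{g\left( a/y\right)}{y^{3/2-ir}}\,F\left( \tfrac{1}{2}+ir,\tfrac{1}{2}+ir,1+2ir;-y\right)dy,$$ where $F(\alpha,\beta,\gamma;z)={}_2F_1(\alpha,\beta;\gamma;z)$ is the Gauss hypergeometric function (analytically continued to $\mathbb{C}\setminus[1,\infty)$). (In the application $Z=M/f$.) *)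

theory Defs
  imports "HOL-Complex_Analysis.Complex_Analysis"
begin

definition hyp2F1_domain :: "complex set" where
  "hyp2F1_domain = - (complex_of_real ` {1..})"

(* The series fps_hypergeo [a, b] [c] 1 has coefficients (a)_n (b)_n / ((c)_n n!).  Its
   continuation to the slit plane is unique (hyp2F1_eqI below); values outside the slit plane,
   or for c a nonpositive integer, are not meant to carry any meaning. *)
definition hyp2F1 :: "complex \<Rightarrow> complex \<Rightarrow> complex \<Rightarrow> complex \<Rightarrow> complex" where
  "hyp2F1 a b c =
     (SOME F. F holomorphic_on hyp2F1_domain \<and> F has_fps_expansion fps_hypergeo [a, b] [c] 1)"

lemma open_hyp2F1_domain: "open hyp2F1_domain"
proof -
  have "closed (complex_of_real ` {1..})"
    using closed_injective_linear_image[of "{1..}" complex_of_real]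
    by (simp add: bounded_linear_of_real bounded_linear.linear inj_on_def)
  thus ?thesis unfolding hyp2F1_domain_def by (rule open_Compl)
qed

lemma zero_in_hyp2F1_domain: "0 \<in> hyp2F1_domain"
  by (auto simp: hyp2F1_domain_def)

lemma connected_hyp2F1_domain: "connected hyp2F1_domain"
proof (rule starlike_imp_connected)
  have "closed_segment 0 z \<subseteq> hyp2F1_domain" if z: "z \<in> hyp2F1_domain" for z
  proof
    fix w assume "w \<in> closed_segment 0 z"
    then obtain u where u: "0 \<le> u" "u \<le> 1" and w: "w = of_real u * z"
      by (auto simp: closed_segment_def scaleR_conv_of_real)
    show "w \<in> hyp2F1_domain"
    proof (rule ccontr)
      assume "w \<notin> hyp2F1_domain"
      then obtain x where x: "x \<ge> 1" "w = of_real x" by (auto simp: hyp2F1_domain_def)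
      with w have "u \<noteq> 0" by auto
      with w x have "z = of_real (x / u)" by (simp add: field_simps)
      moreover have "x / u \<ge> 1" using x u \<open>u \<noteq> 0\<close> by (simp add: field_simps)
      ultimately show False using z unfolding hyp2F1_domain_def by blast
    qed
  qed
  thus "starlike hyp2F1_domain"
    using zero_in_hyp2F1_domain by (auto simp: starlike_def)
qed

lemma hyp2F1_eqI:
  assumes F: "F holomorphic_on hyp2F1_domain" "F has_fps_expansion fps_hypergeo [a, b] [c] 1"
    and z: "z \<in> hyp2F1_domain"
  shows "hyp2F1 a b c z = F z"
proof -
  let ?H = "hyp2F1 a b c"
  have H: "?H holomorphic_on hyp2F1_domain \<and> ?H has_fps_expansion fps_hypergeo [a, b] [c] 1"
    unfolding hyp2F1_def by (rule someI[of _ F]) (use F in blast)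
  have "(\<lambda>w. ?H w - F w) has_fps_expansion (fps_hypergeo [a, b] [c] 1 - fps_hypergeo [a, b] [c] 1)"
    using H F by (intro has_fps_expansion_diff) auto
  hence "(\<lambda>w. ?H w - F w) has_fps_expansion 0" by simp
  moreover have "(\<lambda>w. ?H w - F w) holomorphic_on hyp2F1_domain"
    using H F by (intro holomorphic_intros) auto
  ultimately have "?H z - F z = 0"
    using has_fps_expansion_0_analytic_continuation
      [OF _ _ open_hyp2F1_domain connected_hyp2F1_domain zero_in_hyp2F1_domain z] by blast
  thus ?thesis by simp
qed

(* The function lives on (0, \<infinity>); its values at nonpositive arguments are irrelevant, so every
   condition is restricted to positive arguments. *)
definition smoothed_indicator :: "real \<Rightarrow> (real \<Rightarrow> real) \<Rightarrow> bool" where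
  "smoothed_indicator \<delta> g \<longleftrightarrow>
     (\<forall>n. \<forall>x>0. (deriv ^^ n) g field_differentiable at x) \<and>
     (\<forall>x>0. 0 \<le> g x \<and> g x \<le> 1) \<and>
     (\<forall>x. 1/2 \<le> x \<and> x \<le> 1 \<longrightarrow> g x = 1) \<and>
     (\<forall>x>0. x \<le> 1/2 - \<delta> \<or> x \<ge> 1 + \<delta> \<longrightarrow> g x = 0)"

definition Lambda :: "(real \<Rightarrow> real) \<Rightarrow> real \<Rightarrow> real \<Rightarrow> complex" where
  "Lambda g r Z =
     (let a = 1 / Z; s = 1/2 + \<i> * of_real r in
       (Gamma s)\<^sup>2 / Gamma (1 + 2 * \<i> * of_real r) *
       (LINT y:{0<..}|lborel.
          of_real (g (a / y)) / of_real y powr (3/2 - \<i> * of_real r) *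
          hyp2F1 s s (1 + 2 * \<i> * of_real r) (- of_real y)))"

end

theory Submission
  imports Defs
begin

text \<open>
  Euler's integral turns the Gamma factors times the hypergeometric function at \<open>-y\<close> into
  \<open>\<integral> t\<^bsup>s-1\<^esup> (1-t)\<^bsup>s-1\<^esup> (1+yt)\<^bsup>-s\<^esup> dt\<close> over \<open>(0,1)\<close>, where \<open>s = 1/2 + i r\<close>.  Taking absolute values
  removes \<open>r\<close>, and the remaining integral is \<open>O(y\<^bsup>-1/2\<^esup> (1 + log (1+y)))\<close>.  Since \<open>g(a/y)\<close> restricts
  \<open>y\<close> to \<open>[4a/5, 4a]\<close>, this gives \<open>O(Z (1 + log (1 + 1/Z)))\<close>; the term \<open>Z\<^bsup>3/2\<^esup> r\<close> only serves to
  absorb the constant where \<open>log Z\<close> is small.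
\<close>

section \<open>Holomorphy of integrals depending on a parameter\<close>

text \<open>Differentiation under the integral sign, with a local majorant for \<open>f\<close>
  only. Cauchy's inequality on circles of radius \<open>e\<close> turns the majorant
  \<open>h\<close> into the majorant \<open>h / e\<close> for the derivatives, hence for the
  difference quotients, and dominated convergence applies.\<close>

lemma holomorphic_on_integral:
  fixes f :: "'a \<Rightarrow> complex \<Rightarrow> complex"
  assumes S: "open S"
    and meas: "\<And>z. z \<in> S \<Longrightarrow> (\<lambda>x. f x z) \<in> borel_measurable M"
    and holo: "\<And>x. x \<in> space M \<Longrightarrow> f x holomorphic_on S"
    and bound: "\<And>z. z \<in> S \<Longrightarrow> \<exists>d>0. \<exists>h. integrable M h \<and>
                   (\<forall>x\<in>space M. \<forall>w\<in>ball z d \<inter> S. norm (f x w) \<le> h x)"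
  shows "(\<lambda>z. \<integral>x. f x z \<partial>M) holomorphic_on S"
proof -
  have int: "integrable M (\<lambda>x. f x z)" if z: "z \<in> S" for z
  proof -
    obtain d h where "d > 0" "integrable M h"
      "\<forall>x\<in>space M. \<forall>w\<in>ball z d \<inter> S. norm (f x w) \<le> h x"
      using bound[OF z] by auto
    thus ?thesis
      using z meas[OF z] by (intro Bochner_Integration.integrable_bound[of M h "\<lambda>x. f x z"])
        (auto intro!: AE_I2 order.trans[OF _ abs_ge_self])
  qed
  have "((\<lambda>z. \<integral>x. f x z \<partial>M) has_field_derivative (\<integral>x. deriv (f x) z \<partial>M)) (at z)"
    if z: "z \<in> S" for z
  proof -
    obtain d h where d: "d > 0" and h: "integrable M h"
      and hb: "\<And>x w. x \<in> space M \<Longrightarrow> w \<in> ball z d \<Longrightarrow> w \<in> S \<Longrightarrow> norm (f x w) \<le> h x"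
      using bound[OF z] by auto
    obtain e0 where e0: "e0 > 0" "ball z e0 \<subseteq> S"
      using S z open_contains_ball by blast
    \<comment> \<open>The factor 4 leaves room: a circle of radius \<open>e\<close> about a point of
      \<open>ball z (2 * e)\<close> stays inside \<open>ball z (4 * e)\<close>, where both the
      majorant and holomorphy are available.\<close>
    define e where "e = min d e0 / 4"
    have e: "e > 0" and e4: "\<And>w. w \<in> ball z (4 * e) \<Longrightarrow> w \<in> ball z d \<and> w \<in> S"
      using d e0 by (auto simp: e_def)
    have diff: "norm (f x w - f x z) \<le> h x / e * norm (w - z)"
      if x: "x \<in> space M" and w: "w \<in> ball z (2 * e)" for x w
    proof (rule field_differentiable_bound[where S = "ball z (2 * e)" and f' = "deriv (f x)"])
      fix u assume u: "u \<in> ball z (2 * e)"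
      have sub: "cball u e \<subseteq> ball z (4 * e)"
      proof
        fix v assume "v \<in> cball u e"
        thus "v \<in> ball z (4 * e)"
          using u dist_triangle[of z v u] e by simp
      qed
      hence subS: "cball u e \<subseteq> S" using e4 by blast
      have hol: "f x holomorphic_on cball u e"
        by (rule holomorphic_on_subset[OF holo[OF x] subS])
      have "norm ((deriv ^^ 1) (f x) u) \<le> fact 1 * h x / e ^ 1"
      proof (rule Cauchy_inequality)
        show "f x holomorphic_on ball u e"
          by (rule holomorphic_on_subset[OF hol]) auto
        show "continuous_on (cball u e) (f x)"
          using hol holomorphic_on_imp_continuous_on by blast
        show "norm (f x v) \<le> h x" if "norm (u - v) = e" for v
          using that sub e4 hb[OF x] by (auto simp: dist_norm subset_iff)
      qed (use e in auto)
      thus "norm (deriv (f x) u) \<le> h x / e" by simp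
      show "(f x has_field_derivative deriv (f x) u) (at u within ball z (2 * e))"
        using holo[OF x] S subS e
        by (intro has_field_derivative_at_within[OF holomorphic_derivI]) auto
    qed (use w e in auto)
    \<comment> \<open>Dominated convergence speaks of sequences, so the limit of the difference
      quotient is tested along sequences in the ball.\<close>
    have "((\<lambda>w. ((\<integral>x. f x w \<partial>M) - (\<integral>x. f x z \<partial>M)) / (w - z)) \<longlongrightarrow> (\<integral>x. deriv (f x) z \<partial>M))
            (at z within ball z (2 * e))"
      unfolding tendsto_at_iff_sequentially
    proof (intro allI impI)
      fix X assume X: "\<forall>i. X i \<in> ball z (2 * e) - {z}" and lim: "X \<longlonglongrightarrow> z"
      have XS: "X i \<in> S" "X i \<noteq> z" "X i \<in> ball z (2 * e)" for i
      proof -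
        show "X i \<in> ball z (2 * e)" "X i \<noteq> z" using X by auto
        hence "X i \<in> ball z (4 * e)" using e by auto
        thus "X i \<in> S" using e4 by blast
      qed
      have ptw: "(\<lambda>i. (f x (X i) - f x z) / (X i - z)) \<longlonglongrightarrow> deriv (f x) z" if x: "x \<in> space M" for x
      proof -
        have "(f x has_field_derivative deriv (f x) z) (at z)"
          by (rule holomorphic_derivI[OF holo[OF x] S z])
        hence "((\<lambda>w. (f x w - f x z) / (w - z)) \<longlongrightarrow> deriv (f x) z) (at z)"
          by (simp add: has_field_derivative_iff)
        thus ?thesis
          using lim XS unfolding tendsto_at_iff_sequentially comp_def by auto
      qed
      have meas': "(\<lambda>x. (f x (X i) - f x z) / (X i - z)) \<in> borel_measurable M" for i
        using meas[OF z] meas[OF XS(1)[of i]] by measurable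
      have "(\<lambda>i. \<integral>x. (f x (X i) - f x z) / (X i - z) \<partial>M) \<longlonglongrightarrow> (\<integral>x. deriv (f x) z \<partial>M)"
      proof (rule integral_dominated_convergence[where w = "\<lambda>x. h x / e"])
        \<comment> \<open>The derivative is measurable in \<open>x\<close> as a pointwise limit of
          measurable difference quotients.\<close>
        show "(\<lambda>x. deriv (f x) z) \<in> borel_measurable M"
          by (rule borel_measurable_LIMSEQ_metric[OF meas']) (rule ptw)
        show "integrable M (\<lambda>x. h x / e)" using h by simp
        show "AE x in M. norm ((f x (X i) - f x z) / (X i - z)) \<le> h x / e" for i
          using diff[OF _ XS(3)[of i]] XS(2)[of i]
          by (auto intro!: AE_I2 simp: norm_divide divide_le_eq)
      qed (use ptw meas' in \<open>auto intro!: AE_I2\<close>)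
      also have "(\<lambda>i. \<integral>x. (f x (X i) - f x z) / (X i - z) \<partial>M) =
                 (\<lambda>w. ((\<integral>x. f x w \<partial>M) - (\<integral>x. f x z \<partial>M)) / (w - z)) \<circ> X"
        using int XS(1) z by (auto simp: fun_eq_iff)
      finally show "((\<lambda>w. ((\<integral>x. f x w \<partial>M) - (\<integral>x. f x z \<partial>M)) / (w - z)) \<circ> X)
                       \<longlonglongrightarrow> (\<integral>x. deriv (f x) z \<partial>M)" .
    qed
    thus ?thesis
      using e by (simp add: has_field_derivative_iff at_within_open[of z "ball z (2 * e)"])
  qed
  thus ?thesis
    using holomorphic_on_open[OF S] by blast
qed

section \<open>Euler's Beta integral for complex arguments\<close>

text \<open>Without the endpoints the integrands are continuous, hence measurable, even when the
  powers of \<open>t\<close> and \<open>1 - t\<close> blow up at 0 and 1.\<close>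

abbreviation unit_lborel :: "real measure" where
  "unit_lborel \<equiv> restrict_space lborel {0<..<1}"

lemma borel_measurable_unit_lborel:
  fixes f :: "real \<Rightarrow> 'b::topological_space"
  assumes "continuous_on {0<..<1} f"
  shows "f \<in> borel_measurable unit_lborel"
  using borel_measurable_continuous_on_restrict[OF assms]
  by (simp cong: measurable_cong_sets add: sets_restrict_space)

lemma integrable_Beta_unit_lborel:
  assumes "a > 0" "b > (0::real)"
  shows "integrable unit_lborel (\<lambda>t. t powr (a - 1) * (1 - t) powr (b - 1))"
proof -
  have "set_integrable lborel {0<..<1} (\<lambda>t. t powr (a - 1) * (1 - t) powr (b - 1))"
    by (rule set_integrable_subset[OF integrable_Beta[OF assms]]) auto
  thus ?thesis
    by (simp add: integrable_restrict_space set_integrable_def)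
qed

lemma integral_Beta_real:
  assumes "a > 0" "b > (0::real)"
  shows "(\<integral>t. t powr (a - 1) * (1 - t) powr (b - 1) \<partial>unit_lborel) = Beta a b"
proof -
  let ?f = "\<lambda>t. t powr (a - 1) * (1 - t) powr (b - 1)"
  have "set_integrable lborel {0<..<1} ?f"
    by (rule set_integrable_subset[OF integrable_Beta[OF assms]]) auto
  hence "(LINT t:{0<..<1}|lborel. ?f t) = integral {0<..<1} ?f"
    by (rule set_borel_integral_eq_integral)
  also have "\<dots> = Beta a b"
    using has_integral_Beta_real[OF assms] has_integral_Icc_iff_Ioo by blast
  finally show ?thesis
    by (simp add: set_lebesgue_integral_def integral_restrict_space)
qed

lemma Re_pos_notin_nonpos_Ints: "Re z > 0 \<Longrightarrow> z \<notin> \<int>\<^sub>\<le>\<^sub>0"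
  by (auto elim!: nonpos_Ints_cases)

lemma Beta_real_pos: "a > 0 \<Longrightarrow> b > 0 \<Longrightarrow> Beta a b > (0::real)"
  by (simp add: Beta_def Gamma_real_pos)

lemma norm_Beta_integrand:
  assumes "t \<in> {0<..<1}"
  shows "norm (of_real t powr (a - 1) * of_real (1 - t) powr (b - 1) :: complex) =
           t powr (Re a - 1) * (1 - t) powr (Re b - 1)"
  using assms norm_powr_real_powr[of "of_real t"] norm_powr_real_powr[of "of_real (1 - t)"]
  by (simp add: norm_mult)

lemma continuous_on_Beta_integrand:
  "continuous_on {0<..<1} (\<lambda>t. of_real t powr (a - 1) * of_real (1 - t) powr (b - 1) :: complex)"
  by (intro continuous_intros continuous_on_powr_complex) auto

lemma integrable_Beta_complex:
  fixes a b :: complex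
  assumes "Re a > 0" "Re b > 0"
  shows "integrable unit_lborel (\<lambda>t. of_real t powr (a - 1) * of_real (1 - t) powr (b - 1) :: complex)"
  by (rule Bochner_Integration.integrable_bound[OF integrable_Beta_unit_lborel[OF assms]
       borel_measurable_unit_lborel[OF continuous_on_Beta_integrand]])
     (auto intro!: AE_I2 simp: norm_Beta_integrand simp del: of_real_diff)

text \<open>The substitution of \<open>1 - t\<close> for \<open>t\<close>. It carries what is known
  for one argument of the Beta integral over to the other.\<close>

lemma integral_Beta_complex_commute:
  fixes a b :: complex
  shows "(\<integral>t. of_real t powr (a - 1) * of_real (1 - t) powr (b - 1) \<partial>unit_lborel) =
         (\<integral>t. of_real t powr (b - 1) * of_real (1 - t) powr (a - 1) \<partial>unit_lborel)"
proof -
  have "(\<integral>t. of_real t powr (a - 1) * of_real (1 - t) powr (b - 1) \<partial>unit_lborel) =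
        (\<integral>t. indicator {0<..<1} t *\<^sub>R (of_real t powr (a - 1) * of_real (1 - t) powr (b - 1) :: complex) \<partial>lborel)"
    by (simp add: integral_restrict_space)
  also have "\<dots> = (\<integral>t. indicator {0<..<1} (1 + (-1) * t) *\<^sub>R (of_real (1 + (-1) * t) powr (a - 1) *
                       of_real (1 - (1 + (-1) * t)) powr (b - 1) :: complex) \<partial>lborel)"
    by (subst lborel_integral_real_affine[where c = "-1" and t = 1]) auto
  also have "\<dots> = (\<integral>t. indicator {0<..<1} t *\<^sub>R (of_real t powr (b - 1) * of_real (1 - t) powr (a - 1) :: complex) \<partial>lborel)"
    by (intro Bochner_Integration.integral_cong) (auto simp: indicator_def)
  finally show ?thesis by (simp add: integral_restrict_space)
qed

lemma holomorphic_Beta_integral: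
  fixes b :: complex
  assumes "Re b > 0"
  shows "(\<lambda>a. \<integral>t. of_real t powr (a - 1) * of_real (1 - t) powr (b - 1) \<partial>unit_lborel)
           holomorphic_on {a. Re a > 0}"
proof (rule holomorphic_on_integral)
  show "open {a. Re a > 0}" by (rule open_halfspace_Re_gt)
  show "(\<lambda>t. of_real t powr (z - 1) * of_real (1 - t) powr (b - 1) :: complex) \<in> borel_measurable unit_lborel" for z
    by (rule borel_measurable_unit_lborel[OF continuous_on_Beta_integrand])
  show "(\<lambda>a. of_real t powr (a - 1) * of_real (1 - t) powr (b - 1) :: complex) holomorphic_on {a. Re a > 0}" for t
    by (intro holomorphic_intros)
  fix z :: complex assume z: "z \<in> {a. Re a > 0}"
  show "\<exists>d>0. \<exists>h. integrable unit_lborel h \<and> (\<forall>t\<in>space unit_lborel. \<forall>w\<in>ball z d \<inter> {a. Re a > 0}.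
          norm (of_real t powr (w - 1) * of_real (1 - t) powr (b - 1) :: complex) \<le> h t)"
  \<comment> \<open>On this ball the real part of \<open>w\<close> exceeds \<open>Re z / 2\<close>.
    For \<open>t < 1\<close> a smaller exponent gives a larger power, so the exponent
    \<open>Re z / 2 - 1\<close> dominates, and it is still integrable at 0.\<close>
  proof (intro exI[of _ "Re z / 2"] exI[of _ "\<lambda>t. t powr (Re z / 2 - 1) * (1 - t) powr (Re b - 1)"] conjI ballI)
    show "integrable unit_lborel (\<lambda>t. t powr (Re z / 2 - 1) * (1 - t) powr (Re b - 1))"
      using z assms by (intro integrable_Beta_unit_lborel) auto
    show "Re z / 2 > 0" using z by simp
    fix t w assume t: "t \<in> space unit_lborel" and w: "w \<in> ball z (Re z / 2) \<inter> {a. Re a > 0}"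
    have "Re z - Re w < Re z / 2"
      using w complex_Re_le_cmod[of "z - w"] by (auto simp: dist_norm)
    hence "Re w - 1 \<ge> Re z / 2 - 1" by (simp add: field_simps)
    hence "t powr (Re w - 1) \<le> t powr (Re z / 2 - 1)"
      using t by (intro powr_mono') (auto simp: space_restrict_space)
    thus "norm (of_real t powr (w - 1) * of_real (1 - t) powr (b - 1) :: complex)
            \<le> t powr (Re z / 2 - 1) * (1 - t) powr (Re b - 1)"
      using t by (subst norm_Beta_integrand) (auto simp: space_restrict_space intro!: mult_right_mono)
  qed
qed

text \<open>Identity theorem in the right half-plane, where Beta is holomorphic in its first
  argument: the positive reals accumulate at the interior point 1.\<close>

lemma Beta_eqI_pos_reals:
  fixes F :: "complex \<Rightarrow> complex"
  assumes F: "F holomorphic_on {a. Re a > 0}" and b: "Re b > 0"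
    and eq: "\<And>x. x > 0 \<Longrightarrow> F (of_real x) = Beta (of_real x) b"
    and a: "Re a > 0"
  shows "F a = Beta a b"
proof -
  have "F a - Beta a b = 0"
  proof (rule analytic_continuation[where f = "\<lambda>a. F a - Beta a b" and w = a
           and U = "of_real ` {0<..}" and S = "{a. Re a > 0}" and \<xi> = 1])
    show "(\<lambda>a. F a - Beta a b) holomorphic_on {a. Re a > 0}"
      using b by (intro holomorphic_intros F) (auto dest: Re_pos_notin_nonpos_Ints)
    show "connected {a. Re a > 0}"
      by (intro convex_connected convex_halfspace_Re_gt)
    show "(1::complex) islimpt of_real ` {0<..}"
      unfolding islimpt_approachable
    proof (intro allI impI)
      fix e :: real assume "e > 0"
      thus "\<exists>x'\<in>of_real ` {0<..}. x' \<noteq> (1::complex) \<and> dist x' 1 < e"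
        by (intro bexI[of _ "of_real (1 + e / 2)"] imageI) (auto simp: dist_norm)
    qed
  qed (use a eq in \<open>auto simp: open_halfspace_Re_gt\<close>)
  thus ?thesis by simp
qed

text \<open>The real formula is continued one variable at a time: first in one argument with the
  other real (\<open>half\<close>), then, after exchanging the two by symmetry, in the remaining
  one.\<close>

lemma integral_Beta_complex:
  fixes a b :: complex
  assumes a: "Re a > 0" and b: "Re b > 0"
  shows "(\<integral>t. of_real t powr (a - 1) * of_real (1 - t) powr (b - 1) \<partial>unit_lborel) = Beta a b"
proof -
  have real: "(\<integral>t. of_real t powr (of_real x - 1) * of_real (1 - t) powr (of_real y - 1) \<partial>unit_lborel) =
          Beta (of_real x) (of_real y :: complex)" if "x > 0" "y > 0" for x y
  proof -
    have "(\<integral>t. of_real t powr (of_real x - 1) * of_real (1 - t) powr (of_real y - 1) \<partial>unit_lborel) =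
          (\<integral>t. complex_of_real (t powr (x - 1) * (1 - t) powr (y - 1)) \<partial>unit_lborel)"
    proof (intro Bochner_Integration.integral_cong refl)
      fix t assume "t \<in> space unit_lborel"
      thus "of_real t powr (of_real x - 1) * of_real (1 - t) powr (of_real y - 1) =
              complex_of_real (t powr (x - 1) * (1 - t) powr (y - 1))"
        using powr_of_real[of t "x - 1"] powr_of_real[of "1 - t" "y - 1"]
        by (simp add: space_restrict_space)
    qed
    also have "\<dots> = of_real (Beta x y)"
      by (simp only: integral_complex_of_real integral_Beta_real[OF that])
    finally show ?thesis by (simp add: Beta_complex_of_real)
  qed
  let ?I = "\<lambda>b a :: complex. \<integral>t. of_real t powr (a - 1) * of_real (1 - t) powr (b - 1) \<partial>unit_lborel"
  have half: "?I (of_real y) z = Beta z (of_real y)" if y: "y > 0" and z: "Re z > 0" for y z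
  proof (rule Beta_eqI_pos_reals[where F = "?I (of_real y)"])
    show "?I (of_real y) holomorphic_on {a. Re a > 0}"
      by (rule holomorphic_Beta_integral) (use y in simp)
    show "?I (of_real y) (of_real x) = Beta (of_real x) (of_real y)" if "x > 0" for x
      by (rule real[OF that y])
  qed (use y z in auto)
  show ?thesis
  proof (rule Beta_eqI_pos_reals[where F = "?I b"])
    show "?I b holomorphic_on {a. Re a > 0}"
      by (rule holomorphic_Beta_integral[OF b])
    show "?I b (of_real x) = Beta (of_real x) b" if x: "x > 0" for x
    proof -
      have "?I b (of_real x) = ?I (of_real x) b"
        by (rule integral_Beta_complex_commute)
      thus ?thesis using half[OF x b] by (simp only: Beta_commute)
    qed
  qed (use a b in auto)
qed

section \<open>Euler's integral for the hypergeometric function\<close>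

text \<open>Otherwise \<open>z * t\<close> would be a real number at least 1, and dividing by
  \<open>t\<close> would put \<open>z\<close> on the slit. Hence the principal power in Euler's
  kernel never meets its branch cut.\<close>

lemma one_minus_mult_notin_nonpos_Reals:
  assumes z: "z \<in> hyp2F1_domain" and t: "t \<in> {0..1}"
  shows "1 - z * of_real t \<notin> \<real>\<^sub>\<le>\<^sub>0"
proof
  assume "1 - z * of_real t \<in> \<real>\<^sub>\<le>\<^sub>0"
  then obtain x where x: "x \<le> 0" "1 - z * of_real t = of_real x"
    by (auto elim!: nonpos_Reals_cases)
  hence eq: "z * of_real t = of_real (1 - x)" by (simp add: algebra_simps)
  hence "t \<noteq> 0" using x by (auto simp del: of_real_diff)
  hence "z = of_real ((1 - x) / t)" using eq by (simp add: field_simps)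
  moreover have "(1 - x) / t \<ge> 1" using x t \<open>t \<noteq> 0\<close> by (simp add: field_simps)
  ultimately show False using z unfolding hyp2F1_domain_def by blast
qed

lemma continuous_on_Euler_kernel:
  assumes "A \<subseteq> hyp2F1_domain"
  shows "continuous_on (A \<times> {0..1}) (\<lambda>(z, t). (1 - z * of_real t) powr (- a))"
proof -
  have "continuous_on (- \<real>\<^sub>\<le>\<^sub>0) (\<lambda>w::complex. w powr (- a))"
    by (intro holomorphic_on_imp_continuous_on holomorphic_intros) auto
  moreover have "continuous_on (A \<times> {0..1}) (\<lambda>(z, t). 1 - z * complex_of_real t)"
    by (auto simp: case_prod_beta' intro!: continuous_intros)
  ultimately have "continuous_on (A \<times> {0..1}) (\<lambda>p. (case p of (z, t) \<Rightarrow> 1 - z * of_real t) powr (- a))"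
    by (rule continuous_on_compose2) (use assms one_minus_mult_notin_nonpos_Reals in auto)
  thus ?thesis by (simp add: case_prod_beta')
qed

lemma holomorphic_Euler_integral:
  assumes b: "Re b > 0" and c: "Re c > Re b"
  shows "(\<lambda>z. \<integral>t. of_real t powr (b - 1) * of_real (1 - t) powr (c - b - 1) *
            (1 - z * of_real t) powr (- a) \<partial>unit_lborel) holomorphic_on hyp2F1_domain"
proof (rule holomorphic_on_integral)
  let ?w = "\<lambda>t. of_real t powr (b - 1) * of_real (1 - t) powr (c - b - 1) :: complex"
  have w: "integrable unit_lborel ?w"
    using b c by (intro integrable_Beta_complex) auto
  show "open hyp2F1_domain" by (rule open_hyp2F1_domain)
  show "(\<lambda>t. ?w t * (1 - z * of_real t) powr (- a)) \<in> borel_measurable unit_lborel"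
    if z: "z \<in> hyp2F1_domain" for z
  proof (rule borel_measurable_unit_lborel, rule continuous_on_mult)
    show "continuous_on {0<..<1} ?w" by (rule continuous_on_Beta_integrand)
    have "continuous_on {0<..<1} (\<lambda>t. (\<lambda>(z, t). (1 - z * of_real t) powr (- a)) (z, t))"
      by (rule continuous_on_compose2[OF continuous_on_Euler_kernel[of "{z}"]])
         (use z in \<open>auto intro!: continuous_intros\<close>)
    thus "continuous_on {0<..<1} (\<lambda>t. (1 - z * of_real t) powr (- a))" by simp
  qed
  show "(\<lambda>z. ?w t * (1 - z * of_real t) powr (- a)) holomorphic_on hyp2F1_domain"
    if "t \<in> space unit_lborel" for t
    using that one_minus_mult_notin_nonpos_Reals
    by (intro holomorphic_intros) (auto simp: space_restrict_space)
  fix z assume "z \<in> hyp2F1_domain"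
  then obtain d where d: "d > 0" "cball z d \<subseteq> hyp2F1_domain"
    using open_hyp2F1_domain open_contains_cball by blast
  \<comment> \<open>The kernel is jointly continuous up to the endpoints of the interval, hence
    bounded for \<open>z\<close> in a closed disc. All singular behaviour in \<open>t\<close> sits
    in the integrable Beta weight.\<close>
  have "compact ((\<lambda>(z, t). (1 - z * of_real t) powr (- a)) ` (cball z d \<times> {0..1::real}))"
    by (intro compact_continuous_image continuous_on_Euler_kernel d compact_Times) auto
  then obtain B where B: "\<And>w t. w \<in> cball z d \<Longrightarrow> t \<in> {0..1} \<Longrightarrow> norm ((1 - w * of_real t) powr (- a)) \<le> B"
    by (force dest!: compact_imp_bounded simp: bounded_iff)
  show "\<exists>d>0. \<exists>h. integrable unit_lborel h \<and> (\<forall>t\<in>space unit_lborel. \<forall>w\<in>ball z d \<inter> hyp2F1_domain.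
          norm (?w t * (1 - w * of_real t) powr (- a)) \<le> h t)"
  proof (intro exI[of _ d] exI[of _ "\<lambda>t. norm (?w t) * B"] conjI ballI)
    show "integrable unit_lborel (\<lambda>t. norm (?w t) * B)"
      using integrable_norm[OF w] by (rule integrable_mult_left)
    fix t w assume "t \<in> space unit_lborel" "w \<in> ball z d \<inter> hyp2F1_domain"
    thus "norm (?w t * (1 - w * of_real t) powr (- a)) \<le> norm (?w t) * B"
      unfolding norm_mult[of "?w t"] by (intro mult_left_mono B) (auto simp: space_restrict_space)
  qed (use d in auto)
qed

text \<open>These are the moments of the Beta weight. With \<open>d = c - b\<close> they supply the
  factor \<open>(b)_n / (c)_n\<close> of the hypergeometric coefficients.\<close>

lemma Beta_plus_of_nat_left:
  fixes b d :: complex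
  assumes "Re b > 0" "Re d > 0"
  shows "Beta (b + of_nat n) d = Beta b d * pochhammer b n / pochhammer (b + d) n"
proof -
  have "b \<notin> \<int>\<^sub>\<le>\<^sub>0" "b + d \<notin> \<int>\<^sub>\<le>\<^sub>0" "b + d + of_nat n \<notin> \<int>\<^sub>\<le>\<^sub>0"
    using assms by (auto intro!: Re_pos_notin_nonpos_Ints add_pos_nonneg)
  thus ?thesis
    by (simp add: Beta_def pochhammer_Gamma Gamma_eq_zero_iff field_simps)
qed

text \<open>The kernel is expanded by the binomial series and integrated term by term against the
  Beta weight.\<close>

lemma Euler_integral_sums:
  assumes b: "Re b > 0" and c: "Re c > Re b" and u: "norm u < 1"
  shows "(\<lambda>n. Beta b (c - b) * fps_nth (fps_hypergeo [a, b] [c] 1) n * u ^ n) sums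
           (\<integral>t. of_real t powr (b - 1) * of_real (1 - t) powr (c - b - 1) *
              (1 - u * of_real t) powr (- a) \<partial>unit_lborel)"
proof -
  define w :: "real \<Rightarrow> complex" where
    "w = (\<lambda>t. of_real t powr (b - 1) * of_real (1 - t) powr (c - b - 1))"
  have w: "integrable unit_lborel w"
    unfolding w_def using b c by (intro integrable_Beta_complex) auto
  define f where "f = (\<lambda>n t. w t * ((- a gchoose n) * (- u * of_real t) ^ n))"
  \<comment> \<open>A majorant of the binomial terms that is free of \<open>t\<close>, because
    \<open>0 < t < 1\<close>.\<close>
  define q where "q = (\<lambda>n. norm ((- a gchoose n) * u ^ n))"
  have "summable q" unfolding q_def
  proof (rule powser_insidea)
    \<comment> \<open>The point \<open>(1 + norm u) / 2\<close> lies strictly between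
      \<open>norm u\<close> and 1; convergence of the binomial series there forces absolute
      convergence at \<open>u\<close>.\<close>
    have "norm (complex_of_real ((1 + norm u) / 2)) < 1"
      unfolding norm_of_real using u by simp
    from gen_binomial_complex[OF this]
    show "summable (\<lambda>n. (- a gchoose n) * complex_of_real ((1 + norm u) / 2) ^ n)"
      by (rule sums_summable)
    show "norm u < norm (complex_of_real ((1 + norm u) / 2))"
      unfolding norm_of_real using u by simp
  qed
  have f_le: "norm (f n t) \<le> norm (w t) * q n" if "t \<in> space unit_lborel" for n t
  proof -
    have "norm (f n t) = norm (w t) * (q n * t ^ n)"
      using that by (simp add: f_def q_def norm_mult norm_power power_mult_distrib space_restrict_space)
    also have "\<dots> \<le> norm (w t) * (q n * 1)"
      using that by (intro mult_left_mono power_le_one) (auto simp: q_def space_restrict_space)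
    finally show ?thesis by simp
  qed
  have f_sums: "(\<lambda>n. f n t) sums (w t * (1 - u * of_real t) powr (- a))" if "t \<in> space unit_lborel" for t
  proof -
    have "norm (- u * of_real t) \<le> norm u * 1"
      using that unfolding norm_mult by (intro mult_mono) (auto simp: space_restrict_space)
    hence "norm (- u * of_real t) < 1" using u by simp
    from sums_mult[OF gen_binomial_complex[OF this, of "- a"], of "w t"]
    show ?thesis by (simp add: f_def)
  qed
  \<comment> \<open>Absorbing \<open>t ^ n\<close> into the first exponent turns each term into a
    Beta integrand with \<open>b\<close> shifted by \<open>n\<close>.\<close>
  have f_eq: "f n t = ((- a gchoose n) * (- u) ^ n) *
                (of_real t powr (b + of_nat n - 1) * of_real (1 - t) powr (c - b - 1))"
    if "t \<in> space unit_lborel" for n t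
  proof -
    have "of_real t powr (b + of_nat n - 1) = of_real t powr (b - 1) * complex_of_real t ^ n"
      using that powr_add[of "of_real t" "b - 1" "of_nat n"]
      by (simp add: space_restrict_space powr_nat algebra_simps)
    thus ?thesis unfolding f_def w_def power_mult_distrib[of "- u"] by (simp add: mult_ac)
  qed
  have f_int: "integrable unit_lborel (f n)" for n
  proof (subst Bochner_Integration.integrable_cong[OF refl f_eq])
    show "integrable unit_lborel (\<lambda>t. ((- a gchoose n) * (- u) ^ n) *
            (of_real t powr (b + of_nat n - 1) * of_real (1 - t) powr (c - b - 1)))"
      using b c by (intro integrable_mult_right integrable_Beta_complex) (auto intro: add_pos_nonneg)
  qed
  have "(\<lambda>n. \<integral>t. f n t \<partial>unit_lborel) sums (\<integral>t. (\<Sum>n. f n t) \<partial>unit_lborel)"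
  proof (rule sums_integral[OF f_int])
    show "AE t in unit_lborel. summable (\<lambda>n. norm (f n t))"
    proof (rule AE_I2)
      fix t assume t: "t \<in> space unit_lborel"
      show "summable (\<lambda>n. norm (f n t))"
      proof (rule summable_comparison_test'[where N = 0])
        show "summable (\<lambda>n. norm (w t) * q n)"
          by (rule summable_mult[OF \<open>summable q\<close>])
        show "norm (norm (f n t)) \<le> norm (w t) * q n" for n
          using f_le[OF t] by simp
      qed
    qed
    show "summable (\<lambda>n. \<integral>t. norm (f n t) \<partial>unit_lborel)"
    proof (rule summable_comparison_test'[where N = 0])
      show "summable (\<lambda>n. (\<integral>t. norm (w t) \<partial>unit_lborel) * q n)"
        by (rule summable_mult[OF \<open>summable q\<close>])
      fix n
      have "(\<integral>t. norm (f n t) \<partial>unit_lborel) \<le> (\<integral>t. norm (w t) * q n \<partial>unit_lborel)"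
        using f_le f_int w by (intro integral_mono) auto
      thus "norm (\<integral>t. norm (f n t) \<partial>unit_lborel) \<le> (\<integral>t. norm (w t) \<partial>unit_lborel) * q n"
        by simp
    qed
  qed
  moreover have "(\<integral>t. (\<Sum>n. f n t) \<partial>unit_lborel) = (\<integral>t. w t * (1 - u * of_real t) powr (- a) \<partial>unit_lborel)"
    using f_sums by (intro Bochner_Integration.integral_cong refl) (simp add: sums_iff)
  moreover have "(\<integral>t. f n t \<partial>unit_lborel) = Beta b (c - b) * fps_nth (fps_hypergeo [a, b] [c] 1) n * u ^ n" for n
  proof -
    have "(\<integral>t. f n t \<partial>unit_lborel) = ((- a gchoose n) * (- u) ^ n) * Beta (b + of_nat n) (c - b)"
      using b c by (subst Bochner_Integration.integral_cong[OF refl f_eq])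
        (simp_all add: integral_Beta_complex del: of_real_diff)
    also have "Beta (b + of_nat n) (c - b) = Beta b (c - b) * pochhammer b n / pochhammer c n"
      using b c by (subst Beta_plus_of_nat_left) auto
    \<comment> \<open>The sign from rewriting the binomial coefficient as a Pochhammer symbol
      cancels the sign of \<open>(- u) ^ n\<close>.\<close>
    also have "(- a gchoose n) * (- u) ^ n = pochhammer a n / fact n * u ^ n"
    proof -
      have "(- 1) ^ n * (- 1) ^ n = (1 :: complex)" by (simp flip: power_mult_distrib)
      thus ?thesis unfolding gbinomial_pochhammer power_minus[of u] by simp
    qed
    finally show ?thesis by (simp add: mult_ac)
  qed
  ultimately show ?thesis by (simp add: w_def)
qed

text \<open>The integral divided by \<open>Beta b (c - b)\<close> is holomorphic on the slit plane
  and has the hypergeometric series at 0, so uniqueness of the continuation applies.\<close>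

lemma hyp2F1_Euler_integral:
  assumes b: "Re b > 0" and c: "Re c > Re b" and z: "z \<in> hyp2F1_domain"
  shows "Beta b (c - b) * hyp2F1 a b c z =
           (\<integral>t. of_real t powr (b - 1) * of_real (1 - t) powr (c - b - 1) *
              (1 - z * of_real t) powr (- a) \<partial>unit_lborel)"
proof -
  define I where "I = (\<lambda>z. \<integral>t. of_real t powr (b - 1) * of_real (1 - t) powr (c - b - 1) *
              (1 - z * of_real t) powr (- a) \<partial>unit_lborel)"
  \<comment> \<open>In HOL \<open>Gamma\<close> takes the value 0 at its poles and division by 0
    gives 0, so all three arguments must avoid the nonpositive integers.\<close>
  have "b \<notin> \<int>\<^sub>\<le>\<^sub>0" "c - b \<notin> \<int>\<^sub>\<le>\<^sub>0" "c \<notin> \<int>\<^sub>\<le>\<^sub>0"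
    using b c by (auto intro!: Re_pos_notin_nonpos_Ints)
  hence nz: "Beta b (c - b) \<noteq> 0"
    by (simp add: Beta_def Gamma_eq_zero_iff)
  have "hyp2F1 a b c z = I z / Beta b (c - b)"
  proof (rule hyp2F1_eqI[OF _ _ z])
    show "(\<lambda>z. I z / Beta b (c - b)) holomorphic_on hyp2F1_domain"
      using nz unfolding I_def
      by (intro holomorphic_on_divide holomorphic_Euler_integral b c holomorphic_on_const) auto
    show "(\<lambda>z. I z / Beta b (c - b)) has_fps_expansion fps_hypergeo [a, b] [c] 1"
    proof (rule has_fps_expansionI)
      have "eventually (\<lambda>u::complex. u \<in> ball 0 1) (nhds 0)"
        by (intro eventually_nhds_in_open) auto
      thus "eventually (\<lambda>u. (\<lambda>n. fps_nth (fps_hypergeo [a, b] [c] 1) n * u ^ n) sums (I u / Beta b (c - b))) (nhds 0)"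
      proof eventually_elim
        case (elim u)
        hence "norm u < 1" by simp
        from sums_divide[OF Euler_integral_sums[OF b c this, of a], of "Beta b (c - b)"]
        show ?case using nz by (simp add: I_def mult.assoc del: fps_hypergeo_nth)
      qed
    qed
  qed
  thus ?thesis using nz by (simp add: I_def)
qed

section \<open>Bounds for the hypergeometric factor on the negative axis\<close>

text \<open>
  Since \<open>1 + y t \<ge> (1 + y) t\<close> on \<open>[0,1]\<close>, weakening the exponent of the Euler kernel from \<open>Re a\<close> to
  \<open>\<rho>\<close> leaves another Beta integral.  The logarithm arises below from \<open>Re b - \<rho> = 1 / (2 + log (1+y))\<close>.
\<close>

lemma norm_Beta_hyp2F1_neg_le:
  assumes b: "Re b > 0" and c: "Re c > Re b" and y: "y \<ge> 0"
    and \<rho>: "0 \<le> \<rho>" "\<rho> \<le> Re a" "\<rho> < Re b"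
  shows "norm (Beta b (c - b) * hyp2F1 a b c (- of_real y)) \<le>
           (1 + y) powr (- \<rho>) * Beta (Re b - \<rho>) (Re c - Re b)"
proof -
  have dom: "- complex_of_real y \<in> hyp2F1_domain"
  proof -
    have "Re (- complex_of_real y) < 1" using y by simp
    thus ?thesis by (auto simp: hyp2F1_domain_def simp del: of_real_minus)
  qed
  let ?h = "\<lambda>t. (1 + y) powr (- \<rho>) * (t powr (Re b - \<rho> - 1) * (1 - t) powr (Re c - Re b - 1))"
  have "norm (Beta b (c - b) * hyp2F1 a b c (- of_real y)) \<le>
          (\<integral>t. norm (of_real t powr (b - 1) * of_real (1 - t) powr (c - b - 1) *
              (1 - (- of_real y) * of_real t) powr (- a)) \<partial>unit_lborel)"
    unfolding hyp2F1_Euler_integral[OF b c dom] by (rule integral_norm_bound)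
  also have "\<dots> \<le> (\<integral>t. ?h t \<partial>unit_lborel)"
  proof (rule integral_mono')
    show "integrable unit_lborel ?h"
      using c \<rho> by (intro integrable_mult_right integrable_Beta_unit_lborel) auto
    fix t assume "t \<in> space unit_lborel"
    hence t: "0 < t" "t < 1" by (auto simp: space_restrict_space)
    have yt: "1 + y * t \<ge> 1" using y t by simp
    have "norm ((1 - (- complex_of_real y) * of_real t) powr (- a)) = (1 + y * t) powr (- Re a)"
      using norm_powr_real_powr[of "of_real (1 + y * t)" "- a"] yt by simp
    also have "\<dots> \<le> (1 + y * t) powr (- \<rho>)"
      using yt \<rho> by (intro powr_mono) auto
    also have "\<dots> \<le> ((1 + y) * t) powr (- \<rho>)"
      using y t \<rho> by (intro powr_mono2' mult_pos_pos) (auto simp: algebra_simps)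
    also have "\<dots> = (1 + y) powr (- \<rho>) * t powr (- \<rho>)"
      using y t by (intro powr_mult)
    finally have "norm (of_real t powr (b - 1) * of_real (1 - t) powr (c - b - 1) *
              (1 - (- complex_of_real y) * of_real t) powr (- a)) \<le>
            (t powr (Re b - 1) * (1 - t) powr (Re c - Re b - 1)) * ((1 + y) powr (- \<rho>) * t powr (- \<rho>))"
      using t by (subst norm_mult, subst norm_Beta_integrand) (auto intro!: mult_left_mono)
    also have "\<dots> = ?h t"
      using t powr_add[of t "Re b - 1" "- \<rho>"] by (simp add: algebra_simps)
    finally show "norm (of_real t powr (b - 1) * of_real (1 - t) powr (c - b - 1) *
              (1 - (- complex_of_real y) * of_real t) powr (- a)) \<le> ?h t" .
  qed auto
  also have "\<dots> = (1 + y) powr (- \<rho>) * Beta (Re b - \<rho>) (Re c - Re b)"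
    using c \<rho> by (simp add: integral_Beta_real)
  finally show ?thesis .
qed

text \<open>The recurrence in the first argument isolates the simple pole at 0. What remains,
  \<open>Beta (\<epsilon> + 1) (1/2)\<close>, is at most \<open>Beta 1 (1/2)\<close> by
  monotonicity.\<close>

lemma Beta_half_le:
  assumes "0 < \<epsilon>" "\<epsilon> \<le> 1/2"
  shows "Beta \<epsilon> (1/2) \<le> Beta 1 (1/2) / (\<epsilon>::real)"
proof -
  have nonpos: "\<epsilon> \<notin> \<int>\<^sub>\<le>\<^sub>0" using assms by (auto elim!: nonpos_Ints_cases)
  have "0 \<le> Beta (\<epsilon> + 1) (1/2)"
    using assms by (intro less_imp_le Beta_real_pos) auto
  hence "(\<epsilon> + 1/2) * Beta (\<epsilon> + 1) (1/2) \<le> 1 * Beta (\<epsilon> + 1) (1/2)"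
    using assms by (intro mult_right_mono) auto
  hence "\<epsilon> * Beta \<epsilon> (1/2) \<le> Beta (\<epsilon> + 1) (1/2)"
    by (simp only: Beta_plus1_left[OF nonpos] mult_1)
  also have "\<dots> \<le> Beta 1 (1/2)"
    using assms by (intro Beta_real_mono) auto
  finally show ?thesis using assms by (simp add: field_simps)
qed

text \<open>Since \<open>1 + 2ir = 2s\<close>, the Gamma quotient is exactly
  \<open>Beta s s\<close>, so the preceding bound applies directly and is uniform in
  \<open>r\<close>.\<close>

lemma norm_Gamma_hyp2F1_half_le:
  fixes r y :: real
  defines "s \<equiv> 1/2 + \<i> * of_real r"
  assumes y: "y > 0"
  shows "norm ((Gamma s)\<^sup>2 / Gamma (1 + 2 * \<i> * of_real r) *
           hyp2F1 s s (1 + 2 * \<i> * of_real r) (- of_real y)) \<le>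
         exp 1 * Beta 1 (1/2) * y powr (- (1/2)) * (2 + ln (1 + y))"
proof -
  \<comment> \<open>This balances \<open>(1 + y) powr \<epsilon>\<close>, which stays below
    \<open>exp 1\<close>, against the pole \<open>1 / \<epsilon>\<close>. The summand 2 ensures
    \<open>\<epsilon> \<le> 1/2\<close> for small \<open>y\<close> too.\<close>
  define \<epsilon> where "\<epsilon> = 1 / (2 + ln (1 + y))"
  have ln: "ln (1 + y) > 0" using y by simp
  have \<epsilon>: "0 < \<epsilon>" "\<epsilon> \<le> 1/2" using ln by (auto simp: \<epsilon>_def field_simps)
  have s: "1 + 2 * \<i> * of_real r = s + s" by (simp add: s_def)
  have "norm (Beta s (s + s - s) * hyp2F1 s s (s + s) (- of_real y)) \<le>
          (1 + y) powr (- (1/2 - \<epsilon>)) * Beta (Re s - (1/2 - \<epsilon>)) (Re (s + s) - Re s)"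
    by (rule norm_Beta_hyp2F1_neg_le) (use y \<epsilon> in \<open>auto simp: s_def\<close>)
  also have "\<dots> = (1 + y) powr \<epsilon> * (1 + y) powr (- (1/2)) * Beta \<epsilon> (1/2)"
    by (simp add: s_def flip: powr_add)
  also have "\<dots> \<le> exp 1 * y powr (- (1/2)) * (Beta 1 (1/2) / \<epsilon>)"
  proof (intro mult_mono Beta_half_le \<epsilon>)
    have "\<epsilon> * ln (1 + y) \<le> 1" using ln by (simp add: \<epsilon>_def field_simps)
    thus "(1 + y) powr \<epsilon> \<le> exp 1" using y by (simp add: powr_def)
    show "(1 + y) powr (- (1/2)) \<le> y powr (- (1/2))"
      using y by (intro powr_mono2') auto
    show "0 \<le> Beta \<epsilon> (1/2)"
      using \<epsilon> by (intro less_imp_le Beta_real_pos) auto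
  qed auto
  finally show ?thesis
    unfolding s by (simp add: Beta_def power2_eq_square \<epsilon>_def mult_ac)
qed

section \<open>The integral over y and the absorption of the constant\<close>

text \<open>The endpoints are those of the extreme case \<open>\<delta> = 1/4\<close>; this makes
  the final constant independent of \<open>\<delta>\<close> and \<open>g\<close>.\<close>

lemma smoothed_indicator_support:
  assumes "smoothed_indicator \<delta> g" "\<delta> \<le> 1/4" "x > 0" "g x \<noteq> 0"
  shows "1/4 < x" "x < 5/4"
proof -
  have "\<not> (x \<le> 1/2 - \<delta> \<or> x \<ge> 1 + \<delta>)"
    using assms unfolding smoothed_indicator_def by blast
  thus "1/4 < x" "x < 5/4" using assms(2) by auto
qed

lemma norm_Lambda_le:
  assumes \<delta>: "\<delta> \<le> 1/4" and g: "smoothed_indicator \<delta> g" and Z: "Z > 0"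
  shows "norm (Lambda g r Z) \<le> 5 * exp 1 * Beta 1 (1/2) * (Z * (2 + ln (1 + 4 / Z)))"
proof -
  define s where "s = 1/2 + \<i> * complex_of_real r"
  define P where "P = (Gamma s)\<^sup>2 / Gamma (1 + 2 * \<i> * of_real r)"
  define H where "H = (\<lambda>y::real. hyp2F1 s s (1 + 2 * \<i> * of_real r) (- of_real y))"
  define K where "K = exp 1 * Beta 1 (1/2 :: real)"
  \<comment> \<open>The condition \<open>1/4 < 1 / (Z * y) < 5/4\<close> solved for \<open>y\<close>
    gives the interval from \<open>l\<close> to \<open>u\<close>.\<close>
  define l where "l = 4 / (5 * Z)"
  define u where "u = 4 / Z"
  \<comment> \<open>The decreasing factor \<open>y powr (- 2)\<close> is estimated at
    \<open>l\<close>, the increasing logarithm at \<open>u\<close>.\<close>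
  define M where "M = K * (l powr (- 2) * (2 + ln (1 + u)))"
  have K: "K \<ge> 0"
    by (simp add: K_def Beta_real_pos less_imp_le)
  have lu: "0 < l" "l \<le> u" using Z by (auto simp: l_def u_def field_simps)
  have M: "M \<ge> 0" unfolding M_def using K lu by (intro mult_nonneg_nonneg) auto
  define J where
    "J = (\<lambda>y. of_real (g (1 / Z / y)) / of_real y powr (3/2 - \<i> * complex_of_real r) * H y)"
  have bound: "norm (P * (indicator {0<..} y *\<^sub>R J y)) \<le> M * indicator {l..u} y" for y
  proof (cases "y > 0 \<and> g (1 / Z / y) \<noteq> 0")
    case False
    hence zero: "indicator {0<..} y *\<^sub>R J y = 0" by (auto simp: J_def indicator_def)
    show ?thesis unfolding zero using M by simp
  next
    case True
    hence y: "y > 0" and gy: "g (1 / Z / y) \<noteq> 0" by auto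
    have pos: "1 / Z / y > 0" using y Z by simp
    have "1/4 < 1 / Z / y" "1 / Z / y < 5/4"
      by (rule smoothed_indicator_support[OF g \<delta> pos gy])+
    hence yI: "l \<le> y" "y \<le> u" using y Z by (auto simp: l_def u_def field_simps)
    have g1: "0 \<le> g (1 / Z / y)" "g (1 / Z / y) \<le> 1"
      using g pos unfolding smoothed_indicator_def by blast+
    have "norm (of_real y powr (3/2 - \<i> * complex_of_real r)) = y powr (3/2)"
      using norm_powr_real_powr[of "of_real y"] y by simp
    hence "norm (P * (indicator {0<..} y *\<^sub>R J y)) = g (1 / Z / y) * y powr (- (3/2)) * norm (P * H y)"
      using y g1 by (simp add: J_def norm_mult norm_divide powr_minus_divide)
    also have "\<dots> \<le> 1 * y powr (- (3/2)) * (K * y powr (- (1/2)) * (2 + ln (1 + y)))"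
      using norm_Gamma_hyp2F1_half_le[OF y, of r] g1
      by (intro mult_mono) (auto simp: P_def H_def s_def K_def)
    also have "\<dots> = K * (y powr (- 2) * (2 + ln (1 + y)))"
      using powr_add[of y "- (3/2)" "- (1/2)"] by (simp add: mult_ac)
    also have "\<dots> \<le> M"
      unfolding M_def using y yI lu K
      by (intro mult_left_mono mult_mono powr_mono2') auto
    finally show ?thesis using yI by simp
  qed
  have "Lambda g r Z = P * (\<integral>y. indicator {0<..} y *\<^sub>R J y \<partial>lborel)"
    by (simp add: Lambda_def P_def J_def H_def s_def Let_def set_lebesgue_integral_def)
  also have "\<dots> = (\<integral>y. P * (indicator {0<..} y *\<^sub>R J y) \<partial>lborel)"
    by (rule integral_mult_right_zero [symmetric])
  also have "norm \<dots> \<le> (\<integral>y. norm (P * (indicator {0<..} y *\<^sub>R J y)) \<partial>lborel)"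
    by (rule integral_norm_bound)
  \<comment> \<open>A nonintegrable function has integral 0 by convention, so an integrable
    nonnegative majorant suffices here.\<close>
  also have "\<dots> \<le> (\<integral>y. M * indicator {l..u} y \<partial>lborel)"
    using M bound by (intro integral_mono' integrable_mult_right integrable_real_indicator)
      (auto simp: emeasure_lborel_Icc_eq)
  also have "\<dots> = M * (u - l)"
    using lu by simp
  \<comment> \<open>The 5 is the product of \<open>25/16\<close> from \<open>l powr (- 2)\<close>
    and \<open>16/5\<close> from the length of the interval.\<close>
  also have "\<dots> = 5 * K * (Z * (2 + ln (1 + 4 / Z)))"
  proof -
    have lp: "l powr (- 2) = 25 * Z\<^sup>2 / 16"
      using Z lu by (simp add: l_def powr_minus_divide power2_eq_square)
    have ul: "u - l = 16 / (5 * Z)"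
      using Z by (simp add: l_def u_def field_simps)
    have "M * (u - l) = K * (25 * Z\<^sup>2 / 16 * (2 + ln (1 + 4 / Z))) * (16 / (5 * Z))"
      by (simp only: M_def ul lp) (simp add: u_def)
    also have "\<dots> = 5 * K * (Z * (2 + ln (1 + 4 / Z)))"
      using Z by (simp add: power2_eq_square)
    finally show ?thesis .
  qed
  finally show ?thesis by (simp add: K_def)
qed

text \<open>The constant 2 is absorbed by \<open>sqrt Z\<close> when \<open>Z\<close> is at least
  1/4, and by the logarithm, then at least 3/4 in absolute value, when \<open>Z\<close> is smaller.
  After multiplication by \<open>Z\<close> the root becomes the term
  \<open>Z powr (3/2)\<close>.\<close>

lemma two_plus_ln_le:
  fixes Z :: real
  assumes Z: "Z > 0"
  shows "2 + ln (1 + 4 / Z) \<le> 20 * (\<bar>ln Z\<bar> + sqrt Z)"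
proof (cases "Z \<ge> 1/4")
  case True
  have "4 / Z \<le> 16" using True by (simp add: field_simps)
  hence "ln (1 + 4 / Z) \<le> ln 17" using Z by (subst ln_le_cancel_iff) (auto intro: add_pos_pos)
  also have "ln 17 \<le> (8::real)"
  proof -
    have "17 \<le> exp (2::real) ^ 4"
      \<comment> \<open>Here \<open>17 \<le> 3 ^ 4\<close> and \<open>3 \<le> exp 2\<close>.\<close>
      using power_mono[of 3 "exp 2 :: real" 4] exp_ge_add_one_self[of "2::real"] by simp
    also have "\<dots> = exp (8::real)" by (simp flip: exp_of_nat_mult)
    finally have "ln 17 \<le> ln (exp (8::real))" by (subst ln_le_cancel_iff) auto
    thus ?thesis by simp
  qed
  finally have "2 + ln (1 + 4 / Z) \<le> 10" by simp
  also have "1/2 \<le> sqrt Z"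
    using True by (intro real_le_rsqrt) (simp add: power2_eq_square)
  hence "10 \<le> 20 * (\<bar>ln Z\<bar> + sqrt Z)" by simp
  finally show ?thesis .
next
  case False
  have "1 + 4 / Z \<le> 5 / Z" using False Z by (simp add: field_simps)
  hence "ln (1 + 4 / Z) \<le> ln (5 / Z)" using Z by (subst ln_le_cancel_iff) (auto intro: add_pos_pos)
  also have "\<dots> = ln 5 - ln Z" using Z by (simp add: ln_div)
  finally have "ln (1 + 4 / Z) \<le> 4 + \<bar>ln Z\<bar>" using ln_le_minus_one[of "5::real"] by simp
  moreover have "\<bar>ln Z\<bar> \<ge> 3/4" using ln_le_minus_one[OF Z] False by simp
  moreover have "sqrt Z \<ge> 0" using Z by (intro real_sqrt_ge_zero) simp
  \<comment> \<open>The left side is at most \<open>6 + \<bar>ln Z\<bar>\<close>, and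
    \<open>19 * (3/4)\<close> exceeds 6.\<close>
  ultimately show ?thesis unfolding distrib_left by linarith
qed

theorem lemma3p1:
  shows "\<exists>C::real. C > 0 \<and>
    (\<forall>(\<delta>::real) (g::real \<Rightarrow> real) (r::real) (Z::real).
       0 < \<delta> \<and> \<delta> \<le> 1/4 \<and> smoothed_indicator \<delta> g \<and> r \<ge> 1 \<and> Z > 0 \<longrightarrow>
       norm (Lambda g r Z) \<le> C * (Z * (ln r + \<bar>ln Z\<bar>) + Z powr (3/2) * r))"
proof (intro exI conjI allI impI; (elim conjE)?)
  define K where "K = 5 * exp 1 * Beta 1 (1/2 :: real)"
  have K: "K > 0" by (simp add: K_def Beta_real_pos)
  show "K * 20 > 0" using K by simp
  fix \<delta> r Z :: real and g
  assume \<delta>: "\<delta> \<le> 1/4" and g: "smoothed_indicator \<delta> g" and r: "r \<ge> 1" and Z: "Z > 0"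
  have "norm (Lambda g r Z) \<le> K * (Z * (2 + ln (1 + 4 / Z)))"
    unfolding K_def by (rule norm_Lambda_le[OF \<delta> g Z])
  also have "\<dots> \<le> K * (Z * (20 * (\<bar>ln Z\<bar> + sqrt Z)))"
    using K Z two_plus_ln_le[OF Z] by (intro mult_left_mono) auto
  also have "\<dots> = K * 20 * (Z * \<bar>ln Z\<bar> + Z powr (3/2) * 1)"
    using Z powr_add[of Z 1 "1/2"] by (simp add: powr_half_sqrt algebra_simps)
  \<comment> \<open>For \<open>r \<ge> 1\<close> we have \<open>ln r \<ge> 0\<close>, so bringing in
    \<open>r\<close> only enlarges the bound.\<close>
  also have "\<dots> \<le> K * 20 * (Z * (ln r + \<bar>ln Z\<bar>) + Z powr (3/2) * r)"
    using K Z r by (intro mult_left_mono add_mono) auto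
  finally show "norm (Lambda g r Z) \<le> K * 20 * (Z * (ln r + \<bar>ln Z\<bar>) + Z powr (3/2) * r)" .
qed

end
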